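(* Let $\phi:\mathbb{R}^n\to\mathbb{R}^n$ be a $C^1$ map, $K\subset\mathbb{R}^n$ a compact set with $\phi(K)\subseteq K$ and $K=\operatorname{cl}(\operatorname{int}K)$, and assume $A(x):=\mathrm{D}\phi(x)\in\mathrm{GL}(n,\mathbb{R})$ for all $x\in K$. For each $x\in K$, $k\in\{1,\ldots,n-1\}$ and $s\in[0,1)$, the function $J^2_{k+s,x}:\mathcal{S}_n^+\to\mathbb{R}$, $$J^2_{k+s,x}(p)=\sum_{i=1}^k\log_2\alpha_i\big(p^{1/2}A(x)p^{-1/2}\big)+s\log_2\alpha_{k+1}\big(p^{1/2}A(x)p^{-1/2}\big),$$ is globally Lipschitz continuous with Lipschitz constant $L=\sqrt n/\ln(2)$ with respect to the distance $d$ on $\mathcal{S}_n^+$.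
   Context: $\alpha_1(M)\ge\cdots\ge\alpha_n(M)$ are the singular values of $M\in\mathbb{R}^{n\times n}$. $\mathcal{S}_n^+$ is the manifold of real symmetric positive definite $n\times n$ matrices with the trace metric $\langle v,w\rangle_p=\operatorname{tr}(p^{-1}vp^{-1}w)$; its Riemannian distance is $d(p,q)=\big(\sum_{i=1}^n\ln^2\lambda_i(p^{-1}q)\big)^{1/2}$, where $\lambda_i(p^{-1}q)$ are the (positive real) eigenvalues of $p^{-1}q$. *)

theory Defs
  imports "HOL-Analysis.Analysis" "HOL-Computational_Algebra.Computational_Algebra"
begin

definition charpoly :: "real^'n^'n \<Rightarrow> real poly" where
  "charpoly M = det (\<chi> i j. (if i = j then [:0, 1:] else 0) - [:M $ i $ j:])"

text \<open>Only the real eigenvalues are collected, with algebraic multiplicity.  The multiset has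
  size \<open>n\<close> whenever all complex eigenvalues of \<open>M\<close> are real; this covers the two uses below, the
  symmetric matrix \<open>M\<^sup>T M\<close> and \<open>p\<^sup>-\<^sup>1 q\<close> for symmetric positive definite \<open>p\<close>, \<open>q\<close>.\<close>

definition eigenvalues :: "real^'n^'n \<Rightarrow> real multiset" where
  "eigenvalues M = proots (charpoly M)"

text \<open>The \<open>i\<close>-th largest singular value of \<open>M\<close>, with \<open>i\<close> ranging over \<open>1, \<dots>, n\<close>.\<close>

definition singular_value :: "nat \<Rightarrow> real^'n^'n \<Rightarrow> real" where
  "singular_value i M =
     sqrt (rev (sorted_list_of_multiset (eigenvalues (transpose M ** M))) ! (i - 1))"

definition spd_matrices :: "(real^'n^'n) set" where
  "spd_matrices = {p. transpose p = p \<and> (\<forall>v. v \<noteq> 0 \<longrightarrow> 0 < v \<bullet> (p *v v))}"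

text \<open>Meaningful for \<open>p \<in> spd_matrices\<close> only.\<close>

definition spd_sqrt :: "real^'n^'n \<Rightarrow> real^'n^'n" where
  "spd_sqrt p = (THE r. r \<in> spd_matrices \<and> r ** r = p)"

text \<open>The Riemannian distance of the trace metric
  \<open>\<langle>v, w\<rangle>\<^sub>p = tr (p\<^sup>-\<^sup>1 v p\<^sup>-\<^sup>1 w)\<close> in its closed form on \<open>spd_matrices\<close>.\<close>

definition spd_dist :: "real^'n^'n \<Rightarrow> real^'n^'n \<Rightarrow> real" where
  "spd_dist p q = sqrt (\<Sum>l\<in>#eigenvalues (matrix_inv p ** q). (ln l)\<^sup>2)"

definition J2 ::
  "(real^'n \<Rightarrow> real^'n) \<Rightarrow> nat \<Rightarrow> real \<Rightarrow> real^'n \<Rightarrow> real^'n^'n \<Rightarrow> real" where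
  "J2 \<phi> k s x p =
     (let B = spd_sqrt p ** jacobian \<phi> (at x) ** matrix_inv (spd_sqrt p)
      in (\<Sum>i = 1..k. log 2 (singular_value i B)) + s * log 2 (singular_value (k + 1) B))"

end

theory Submission
  imports Defs
begin

text \<open>The squared singular values of \<open>p\<^sup>1\<^sup>/\<^sup>2 A p\<^sup>-\<^sup>1\<^sup>/\<^sup>2\<close> are the eigenvalues of \<open>p\<^sup>-\<^sup>1 A\<^sup>T p A\<close>.  Let
  \<open>f p r\<close> be the weighted sum of the logarithms of the ordered eigenvalues of \<open>p\<^sup>-\<^sup>1 A\<^sup>T r A\<close>, with
  weights \<open>1, \<dots>, 1, s, 0, \<dots>, 0\<close>, so that \<open>J\<^sup>2(p) = f p p / (2 ln 2)\<close>.  Each eigenvalue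
  increases with \<open>r\<close> and decreases with \<open>p\<close>, while the unweighted sum of the logarithms is
  \<open>ln det r - ln det p\<close> up to a constant.  As the weights lie in \<open>[0, 1]\<close>, enlarging \<open>r\<close> or shrinking
  \<open>p\<close> raises \<open>f\<close> by at least 0 and at most the change of the log-determinant.  For a common upper
  bound \<open>m\<close> of \<open>p\<close> and \<open>q\<close> this gives
  \<open>f p p \<le> f p m \<le> f m m + ln (det m / det p) \<le> f m q + ln (det m / det p) + ln (det m / det q)\<close>,
  and \<open>f m q \<le> f q q\<close>.  Taking for \<open>m\<close> the maximum of \<open>p\<close> and \<open>q\<close> in a simultaneous diagonalization,
  the two logarithms sum to \<open>\<Sum>\<^sub>i |ln \<lambda>\<^sub>i(p\<^sup>-\<^sup>1 q)| \<le> sqrt n d(p, q)\<close> by Cauchy--Schwarz.\<close>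

section \<open>Diagonal matrices, matrix arithmetic and inverses\<close>

definition diagm :: "('n \<Rightarrow> 'a::zero) \<Rightarrow> 'a^'n^'n" where
  "diagm d = (\<chi> i j. if i = j then d i else 0)"

lemma transpose_diagm [simp]: "transpose (diagm d) = diagm d"
  by (auto simp: diagm_def transpose_def vec_eq_iff)

lemma diagm_mult: "diagm a ** diagm b = diagm (\<lambda>i. a i * (b i :: 'a::semiring_1))"
  by (auto simp: diagm_def matrix_matrix_mult_def vec_eq_iff if_distrib[of "\<lambda>x. x * _"] cong: if_cong)

lemma diagm_one: "diagm (\<lambda>i. 1) = mat 1"
  by (auto simp: diagm_def mat_def)

lemma diagm_mult_vec: "(diagm d *v y) $ i = d i * (y $ i :: 'a::semiring_1)"
  by (simp add: diagm_def matrix_vector_mult_def if_distrib[of "\<lambda>x. x * _"] cong: if_cong)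

lemma matrix_diff_ldistrib: "A ** (B - C) = A ** B - A ** (C :: 'a::ring_1^'n^'m)"
  by (simp add: matrix_matrix_mult_def vec_eq_iff sum_subtractf right_diff_distrib)

lemma matrix_diff_rdistrib: "(A - B) ** C = A ** C - B ** (C :: 'a::ring_1^'n^'m)"
  by (simp add: matrix_matrix_mult_def vec_eq_iff sum_subtractf left_diff_distrib)

lemma matrix_add_rdistrib: "(A + B) ** C = A ** C + B ** (C :: 'a::semiring_1^'n^'m)"
  by (simp add: matrix_matrix_mult_def vec_eq_iff sum.distrib distrib_right)

lemma det_diagm: "det (diagm d) = prod d UNIV"
  by (subst det_diagonal) (auto simp: diagm_def)

lemma inner_diagm: "y \<bullet> (diagm d *v y) = (\<Sum>i\<in>UNIV. d i * (y $ i)\<^sup>2)"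
  by (simp add: inner_vec_def diagm_mult_vec power2_eq_square mult_ac)

lemma inner_mult_vec: "x \<bullet> (A *v y) = (transpose A *v x) \<bullet> (y :: real^'n)"
  by (simp add: dot_lmul_matrix)

lemma matrix_inv_inverse:
  fixes A :: "real^'n^'n"
  assumes "invertible A"
  shows "A ** matrix_inv A = mat 1" "matrix_inv A ** A = mat 1"
  using someI_ex[OF assms[unfolded invertible_def]] by (auto simp: matrix_inv_def)

lemma matrix_inv_eqI:
  fixes A :: "real^'n^'n"
  assumes "A ** B = mat 1"
  shows "matrix_inv A = B"
proof -
  have "invertible A" using assms invertible_right_inverse by blast
  then have "matrix_inv A ** (A ** B) = B" by (simp add: matrix_mul_assoc matrix_inv_inverse)
  then show ?thesis using assms by simp
qed

lemma transpose_matrix_inv: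
  fixes S :: "real^'n^'n"
  assumes "invertible S"
  shows "transpose (matrix_inv S) = matrix_inv (transpose S)"
  using matrix_inv_inverse[OF assms]
  by (metis matrix_inv_eqI matrix_transpose_mul transpose_mat)

section \<open>The spectral theorem\<close>

text \<open>A maximizer \<open>x\<close> of the Rayleigh quotient over the unit sphere of
  \<open>S\<close> is an eigenvector: the quadratic form \<open>g\<close> is nonnegative on
  \<open>S\<close> and vanishes at \<open>x\<close>, so its first variation at \<open>x\<close>
  along the residual \<open>w\<close> is zero, and that variation is a multiple of
  \<open>w \<bullet> w\<close>.\<close>

lemma symmetric_eigenvector_exists:
  fixes A :: "real^'n^'n"
  assumes sym: "transpose A = A" and S: "subspace S" "S \<noteq> {0}"
    and inv: "\<And>x. x \<in> S \<Longrightarrow> A *v x \<in> S"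
  obtains x c where "x \<in> S" "norm x = 1" "A *v x = c *\<^sub>R x"
proof -
  have cpt: "compact (sphere 0 1 \<inter> S)"
    using S by (intro compact_Int_closed closed_subspace) auto
  obtain z where z: "z \<in> S" "z \<noteq> 0"
    using S subspace_0 by blast
  then have "z /\<^sub>R norm z \<in> sphere 0 1 \<inter> S"
    using S by (auto simp: subspace_scale)
  then have ne: "sphere 0 1 \<inter> S \<noteq> {}" by blast
  have cont: "continuous_on (sphere 0 1 \<inter> S) (\<lambda>x. x \<bullet> (A *v x))"
    by (intro continuous_intros matrix_vector_mult_linear_continuous_on)
  obtain x where x: "x \<in> S" "norm x = 1"
    and mx: "\<And>y. y \<in> S \<Longrightarrow> norm y = 1 \<Longrightarrow> y \<bullet> (A *v y) \<le> x \<bullet> (A *v x)"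
    using continuous_attains_sup[OF cpt ne cont] by auto
  define c where "c = x \<bullet> (A *v x)"
  define g where "g y = c * (y \<bullet> y) - y \<bullet> (A *v y)" for y
  have g_nonneg: "g y \<ge> 0" if "y \<in> S" for y
  proof (cases "y = 0")
    case False
    have "(y /\<^sub>R norm y) \<bullet> (A *v (y /\<^sub>R norm y)) \<le> c"
      unfolding c_def using that False S by (intro mx) (auto simp: subspace_scale)
    then have "(y \<bullet> (A *v y)) / (norm y)\<^sup>2 \<le> c"
      by (simp add: matrix_vector_mult_scaleR power2_eq_square divide_simps)
    then show ?thesis
      using False by (simp add: g_def divide_simps dot_square_norm)
  qed (simp add: g_def)
  define w where "w = c *\<^sub>R x - A *v x"
  have wS: "w \<in> S"
    using x S inv by (simp add: w_def subspace_diff subspace_scale)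
  have gx: "g x = 0"
    using x by (simp add: g_def c_def dot_square_norm)
  have "x \<bullet> (A *v w) = w \<bullet> (A *v x)"
    by (subst inner_mult_vec) (simp only: sym inner_commute)
  then have expand: "g (x + t *\<^sub>R w) = 2 * t * (w \<bullet> w) + t\<^sup>2 * g w" for t
    using gx by (simp add: g_def matrix_vector_mult_scaleR matrix_vector_right_distrib
        inner_simps power2_eq_square) (simp add: w_def inner_simps inner_commute algebra_simps)
  have "w \<bullet> w = 0"
  proof (rule ccontr)
    assume "w \<bullet> w \<noteq> 0"
    then have pos: "w \<bullet> w > 0" by simp
    have gw: "g w \<ge> 0" by (rule g_nonneg[OF wS])
    \<comment> \<open>A negative step so short that the linear term dominates:
      \<open>t * g w\<close> stays above \<open>- (w \<bullet> w)\<close>. The added 1 keeps the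
      denominator positive even if \<open>g w = 0\<close>.\<close>
    define t where "t = - (w \<bullet> w) / (g w + 1)"
    have "t < 0" using pos gw by (simp add: t_def)
    have "t * (2 * (w \<bullet> w) + t * g w) \<ge> 0"
      using g_nonneg[of "x + t *\<^sub>R w"] x wS S expand[of t]
      by (simp add: subspace_add subspace_scale power2_eq_square algebra_simps)
    then have "2 * (w \<bullet> w) + t * g w \<le> 0"
      using \<open>t < 0\<close> by (simp add: zero_le_mult_iff)
    moreover have "t * g w \<ge> - (w \<bullet> w)"
      using pos gw by (simp add: t_def divide_simps)
    ultimately show False using pos by linarith
  qed
  then have "A *v x = c *\<^sub>R x" by (simp add: w_def)
  with x that show ?thesis by blast
qed

text \<open>Induction on the dimension: after splitting off a unit eigenvector \<open>x\<close>, its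
  orthogonal complement in \<open>S\<close> is again invariant by symmetry of \<open>A\<close>.
  Formulating this for invariant subspaces avoids restricting \<open>A\<close> to a smaller
  space.\<close>

lemma symmetric_orthonormal_eigenbasis:
  fixes A :: "real^'n^'n"
  assumes sym: "transpose A = A"
  shows "subspace S \<Longrightarrow> (\<And>x. x \<in> S \<Longrightarrow> A *v x \<in> S) \<Longrightarrow>
    \<exists>B \<subseteq> S. pairwise orthogonal B \<and> span B = S \<and> (\<forall>b\<in>B. norm b = 1 \<and> (\<exists>c. A *v b = c *\<^sub>R b))"
proof (induction "dim S" arbitrary: S rule: less_induct)
  case (less S)
  show ?case
  proof (cases "S = {0}")
    case True
    then show ?thesis by (intro exI[of _ "{}"]) auto
  next
    case False
    obtain x c where x: "x \<in> S" "norm x = 1" "A *v x = c *\<^sub>R x"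
      using symmetric_eigenvector_exists[OF sym less.prems(1) False less.prems(2)] by blast
    define T where "T = S \<inter> {y. x \<bullet> y = 0}"
    have T: "subspace T"
      unfolding T_def using less.prems(1) subspace_hyperplane[of x] by (intro subspace_inter)
    have "x \<notin> T" using x by (simp add: T_def dot_square_norm)
    moreover have "T \<subseteq> S" by (auto simp: T_def)
    ultimately have "T \<subset> S" using x(1) by blast
    then have "dim T < dim S"
      using T less.prems(1) by (metis dim_psubset span_eq_iff)
    moreover have "A *v y \<in> T" if "y \<in> T" for y
    proof -
      have "x \<bullet> (A *v y) = (A *v x) \<bullet> y" by (subst inner_mult_vec) (simp only: sym)
      then show ?thesis using that x less.prems by (simp add: T_def)
    qed
    ultimately obtain B where B: "B \<subseteq> T" "pairwise orthogonal B" "span B = T"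
      "\<forall>b\<in>B. norm b = 1 \<and> (\<exists>c. A *v b = c *\<^sub>R b)"
      using less.hyps[of T] T by blast
    have "span (insert x B) = S"
    proof
      show "span (insert x B) \<subseteq> S"
        using B x less.prems by (intro span_minimal) (auto simp: T_def)
      show "S \<subseteq> span (insert x B)"
      proof
        fix y assume y: "y \<in> S"
        have "y - (x \<bullet> y) *\<^sub>R x \<in> T"
          using x y less.prems by (simp add: T_def subspace_diff subspace_scale inner_diff_right dot_square_norm)
        then show "y \<in> span (insert x B)"
          using B(3) by (auto simp: span_breakdown_eq)
      qed
    qed
    moreover have "pairwise orthogonal (insert x B)"
      using B by (auto simp: pairwise_insert orthogonal_def T_def inner_commute)
    ultimately show ?thesis
      using B x by (intro exI[of _ "insert x B"]) (auto simp: T_def)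
  qed
qed

theorem spectral_theorem:
  fixes A :: "real^'n^'n"
  assumes sym: "transpose A = A"
  obtains U :: "real^'n^'n" and d where "orthogonal_matrix U" "transpose U ** A ** U = diagm d"
proof -
  obtain B :: "(real^'n) set" where B: "pairwise orthogonal B" "span B = UNIV"
      "\<And>b. b \<in> B \<Longrightarrow> norm b = 1" "\<And>b. b \<in> B \<Longrightarrow> \<exists>c. A *v b = c *\<^sub>R b"
    using symmetric_orthonormal_eigenbasis[OF sym, of UNIV] by auto
  have ind: "independent B"
    using B(1,3) by (intro pairwise_orthogonal_independent) fastforce+
  then have "card B = CARD('n)"
    using B(2) by (metis dim_UNIV dim_span_eq_card_independent dim_UNIV DIM_cart DIM_real mult.right_neutral)
  then obtain b where b: "bij_betw b (UNIV :: 'n set) B"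
    using ind independent_bound finite_same_card_bij[of "UNIV :: 'n set" B] by (auto simp: finiteI_independent)
  define U :: "real^'n^'n" where "U = (\<chi> i j. b j $ i)"
  have bB: "b i \<in> B" for i using b by (auto simp: bij_betw_def)
  have orth: "b i \<bullet> b j = (if i = j then 1 else 0)" for i j
  proof (cases "i = j")
    case True then show ?thesis using B(3)[OF bB[of j]] by (simp add: dot_square_norm)
  next
    case False
    then have "b i \<noteq> b j" using b by (auto simp: bij_betw_def inj_on_def)
    then show ?thesis using B(1) bB False by (auto simp: pairwise_def orthogonal_def)
  qed
  have tU: "transpose U ** M = (\<chi> i j. b i \<bullet> column j M)" for M :: "real^'n^'n"
    by (simp add: U_def vec_eq_iff matrix_matrix_mult_def transpose_def inner_vec_def column_def)
  have colU: "column j U = b j" for j by (simp add: U_def column_def vec_eq_iff)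
  have "transpose U ** U = mat 1"
    by (simp add: tU colU orth mat_def vec_eq_iff)
  then have oU: "orthogonal_matrix U" by (simp add: orthogonal_matrix)
  obtain d where d: "\<And>j. A *v b j = d j *\<^sub>R b j" using B(4)[OF bB] by metis
  have colAU: "column j (A ** U) = d j *\<^sub>R b j" for j
    using d[of j] by (simp add: vec_eq_iff column_def matrix_matrix_mult_def matrix_vector_mult_def U_def)
  have "transpose U ** A ** U = diagm d"
    by (subst matrix_mul_assoc[symmetric]) (simp add: tU colAU orth diagm_def vec_eq_iff)
  with oU that show ?thesis by blast
qed

section \<open>Eigenvalues of similar and diagonal matrices\<close>

text \<open>The usual determinant argument, run over the polynomial ring: \<open>C\<close> embeds
  real matrices as constant ones, and the scalar matrix \<open>X\<close> commutes with everything,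
  so conjugating \<open>X - C M\<close> conjugates only \<open>M\<close>.\<close>

lemma charpoly_similar:
  fixes M S T :: "real^'n^'n"
  assumes "S ** T = mat 1"
  shows "charpoly (S ** M ** T) = charpoly M"
proof -
  define C :: "real^'n^'n \<Rightarrow> real poly^'n^'n" where "C M = (\<chi> i j. [:M $ i $ j:])" for M
  define X :: "real poly^'n^'n" where "X = diagm (\<lambda>i. [:0, 1:])"
  have sum_pconst: "(\<Sum>i\<in>I. [:f i:]) = [:\<Sum>i\<in>I. f i:]" for f :: "'n \<Rightarrow> real" and I
    by (induction I rule: infinite_finite_induct) auto
  have C_mult: "C (M ** N) = C M ** C N" for M N
    by (simp add: C_def matrix_matrix_mult_def vec_eq_iff sum_pconst mult.commute)
  have C1: "C (mat 1) = mat 1"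
    by (auto simp: C_def mat_def vec_eq_iff)
  have char: "charpoly M = det (X - C M)" for M
    unfolding charpoly_def by (rule arg_cong[of _ _ det]) (simp add: X_def C_def diagm_def vec_eq_iff)
  have XC: "X ** Y = Y ** X" for Y
    by (simp add: X_def diagm_def matrix_matrix_mult_def vec_eq_iff if_distrib[of "\<lambda>x. x * _"]
        if_distrib[of "\<lambda>x. _ * x"] cong: if_cong)
  have CST: "C S ** C T = mat 1" by (metis C1 C_mult assms)
  have "C S ** (X - C M) ** C T = X - C (S ** M ** T)"
    by (simp add: C_mult matrix_diff_ldistrib matrix_diff_rdistrib flip: XC)
       (simp add: CST flip: matrix_mul_assoc)
  then have "charpoly (S ** M ** T) = det (C S) * charpoly M * det (C T)"
    by (metis char det_mul)
  also have "\<dots> = det (C S ** C T) * charpoly M" by (simp add: det_mul)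
  finally show ?thesis by (simp add: CST)
qed

lemma eigenvalues_diagm: "eigenvalues (diagm d) = image_mset d (mset_set UNIV)"
proof -
  have "charpoly (diagm d) = det (diagm (\<lambda>i. [:- d i, 1:]))"
    unfolding charpoly_def by (rule arg_cong[of _ _ det]) (auto simp: diagm_def vec_eq_iff)
  then have "eigenvalues (diagm d) = (\<Sum>i\<in>UNIV. {#d i#})"
    by (simp add: eigenvalues_def det_diagm proots_prod)
  moreover have "(\<Sum>i\<in>I. {#d i#}) = image_mset d (mset_set I)" if "finite I" for I
    using that by (induction rule: finite_induct) auto
  ultimately show ?thesis by simp
qed

section \<open>Simultaneous diagonalization\<close>

lemma spd_matricesD:
  assumes "p \<in> spd_matrices"
  shows "transpose p = p" "v \<noteq> 0 \<Longrightarrow> 0 < v \<bullet> (p *v v)"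
  using assms by (auto simp: spd_matrices_def)

lemma inner_congruence:
  fixes R S :: "real^'n^'n"
  shows "(S *v y) \<bullet> (R *v (S *v y)) = y \<bullet> ((transpose S ** R ** S) *v y)"
proof -
  have "y \<bullet> (transpose S *v w) = (S *v y) \<bullet> w" for w
    using inner_mult_vec[of y "transpose S" w] by (simp only: transpose_transpose)
  then show ?thesis by (simp only: flip: matrix_vector_mul_assoc)
qed

lemma spd_congruence:
  fixes R S :: "real^'n^'n"
  assumes "R \<in> spd_matrices" "invertible S"
  shows "transpose S ** R ** S \<in> spd_matrices"
proof -
  have "S *v v \<noteq> 0" if "v \<noteq> 0" for v
    using that assms(2) by (metis inj_matrix_vector_mult injD mult_zero_right matrix_vector_mult_0_right)
  then show ?thesis
    using assms(1) by (auto simp: spd_matrices_def matrix_transpose_mul matrix_mul_assoc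
        simp flip: inner_congruence)
qed

lemma diagm_spd_iff: "diagm d \<in> spd_matrices \<longleftrightarrow> (\<forall>i. 0 < d i)"
proof
  assume "diagm d \<in> spd_matrices"
  from spd_matricesD(2)[OF this, of "axis i 1" for i] show "\<forall>i. 0 < d i"
    by (auto simp: inner_axis' diagm_mult_vec axis_eq_0_iff)
next
  assume pos: "\<forall>i. 0 < d i"
  have "0 < v \<bullet> (diagm d *v v)" if "v \<noteq> 0" for v
  proof -
    from that obtain i where "v $ i \<noteq> 0" by (auto simp: vec_eq_iff)
    then show ?thesis using pos unfolding inner_diagm
      by (intro sum_pos2[of _ i]) (auto intro!: mult_nonneg_nonneg simp: less_imp_le)
  qed
  then show "diagm d \<in> spd_matrices" by (simp add: spd_matrices_def)
qed

lemma spd_sqrt_exists: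
  assumes "p \<in> spd_matrices"
  obtains r where "r \<in> spd_matrices" "r ** r = p"
proof -
  obtain U d where U: "orthogonal_matrix U" and d: "transpose U ** p ** U = diagm d"
    using spectral_theorem spd_matricesD(1)[OF assms] by metis
  have UU: "U ** transpose U = mat 1" "transpose U ** U = mat 1"
    using U by (auto simp: orthogonal_matrix_def)
  then have inv: "invertible U" "invertible (transpose U)" by (auto simp: invertible_def)
  have pos: "0 < d i" for i
    using spd_congruence[OF assms inv(1)] by (simp add: d diagm_spd_iff)
  define r where "r = U ** diagm (\<lambda>i. sqrt (d i)) ** transpose U"
  have "r \<in> spd_matrices"
    using spd_congruence[OF _ inv(2), of "diagm (\<lambda>i. sqrt (d i))"] pos by (simp add: r_def diagm_spd_iff)
  moreover have "r ** r = U ** (diagm (\<lambda>i. sqrt (d i)) ** (transpose U ** U) ** diagm (\<lambda>i. sqrt (d i))) ** transpose U"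
    by (simp add: r_def matrix_mul_assoc)
  then have "r ** r = U ** diagm d ** transpose U"
    using pos by (simp add: UU diagm_mult less_imp_le)
  then have "r ** r = p"
    by (simp add: matrix_mul_assoc UU flip: d) (simp add: UU flip: matrix_mul_assoc)
  ultimately show ?thesis using that by blast
qed

text \<open>Since \<open>spd_sqrt\<close> is a definite description, uniqueness is essential. For
  \<open>e = r - s\<close>, equality of the squares gives
  \<open>(r + s) ** e + e ** (r + s) = 0\<close>. Testing this on an eigenvector of \<open>e\<close>
  yields twice its eigenvalue times the positive value of the form \<open>r + s\<close>, so every
  eigenvalue of \<open>e\<close> is zero.\<close>

lemma spd_sqrt_unique:
  assumes r: "r \<in> spd_matrices" and s: "s \<in> spd_matrices" and eq: "r ** r = s ** s"
  shows "r = s"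
proof -
  define e where "e = r - s"
  have sym: "transpose e = e" "transpose r = r" "transpose s = s"
    using spd_matricesD(1)[OF r] spd_matricesD(1)[OF s] by (auto simp: e_def transpose_def vec_eq_iff)
  obtain U d where U: "orthogonal_matrix U" and d: "transpose U ** e ** U = diagm d"
    using spectral_theorem sym(1) by metis
  have UU: "U ** transpose U = mat 1" "transpose U ** U = mat 1"
    using U by (auto simp: orthogonal_matrix_def)
  have eU: "e ** U = U ** diagm d"
    by (simp add: matrix_mul_assoc UU flip: d)
  have "d i = 0" for i
  proof -
    define v where "v = U *v axis i 1"
    have v: "v \<noteq> 0"
      by (metis UU(2) axis_eq_0_iff matrix_vector_mul_assoc matrix_vector_mul_lid
          matrix_vector_mult_0_right v_def zero_neq_one)
    have "diagm d *v axis i 1 = d i *\<^sub>R axis i 1"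
      by (auto simp: vec_eq_iff diagm_mult_vec axis_def)
    then have ev: "e *v v = d i *\<^sub>R v"
      by (simp add: v_def matrix_vector_mul_assoc eU matrix_vector_mult_scaleR
          flip: matrix_vector_mul_assoc[of U])
    have "(r + s) ** e + e ** (r + s) = 0"
      using eq by (simp add: e_def matrix_diff_ldistrib matrix_diff_rdistrib
          matrix_add_ldistrib matrix_add_rdistrib)
    then have "0 = v \<bullet> ((r + s) *v (e *v v)) + v \<bullet> (e *v ((r + s) *v v))"
      by (metis inner_zero_right inner_right_distrib matrix_vector_mul_assoc matrix_vector_mult_add_rdistrib matrix_vector_mult_0)
    also have "v \<bullet> (e *v ((r + s) *v v)) = (e *v v) \<bullet> ((r + s) *v v)"
      by (subst inner_mult_vec) (simp only: sym)
    finally have "0 = 2 * d i * (v \<bullet> (r *v v) + v \<bullet> (s *v v))"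
      by (simp add: ev matrix_vector_mult_scaleR matrix_vector_mult_add_rdistrib inner_simps algebra_simps)
    moreover have "v \<bullet> (r *v v) + v \<bullet> (s *v v) > 0"
      using spd_matricesD(2) r s v by (intro add_pos_pos) auto
    ultimately show ?thesis by simp
  qed
  then have "d = (\<lambda>_. 0)" by auto
  then have "diagm d = 0" by (simp add: diagm_def vec_eq_iff)
  then have "e ** (U ** transpose U) = 0"
    by (simp add: matrix_mul_assoc eU)
  then show ?thesis by (simp add: UU e_def)
qed

lemma spd_sqrt:
  assumes "p \<in> spd_matrices"
  shows "spd_sqrt p \<in> spd_matrices" "spd_sqrt p ** spd_sqrt p = p"
proof -
  have "\<exists>!r. r \<in> spd_matrices \<and> r ** r = p"
    using spd_sqrt_exists[OF assms] spd_sqrt_unique by metis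
  from theI'[OF this] show "spd_sqrt p \<in> spd_matrices" "spd_sqrt p ** spd_sqrt p = p"
    by (auto simp: spd_sqrt_def)
qed

lemma spd_invertible:
  assumes "p \<in> spd_matrices"
  shows "invertible p"
proof -
  have "p *v x = 0 \<Longrightarrow> x = 0" for x
    using spd_matricesD(2)[OF assms, of x] by fastforce
  then show ?thesis by (metis invertible_left_inverse matrix_left_invertible_ker)
qed

text \<open>Take \<open>S\<close> to be the inverse square root of \<open>p\<close> followed on the
  right by an orthogonal \<open>U\<close> diagonalizing \<open>r ** R ** r\<close>; the orthogonal
  factor preserves the identity that \<open>p\<close> has become.\<close>

lemma simultaneous_diagonalization:
  fixes R :: "real^'n^'n"
  assumes p: "p \<in> spd_matrices" and R: "transpose R = R"
  obtains S :: "real^'n^'n" and d where "transpose S ** p ** S = mat 1" "transpose S ** R ** S = diagm d"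
proof -
  define r where "r = matrix_inv (spd_sqrt p)"
  note sq = spd_sqrt[OF p]
  have inv: "invertible (spd_sqrt p)" using sq spd_invertible by blast
  note rr = matrix_inv_inverse[OF inv, folded r_def]
  have sym: "transpose r = r"
    using transpose_matrix_inv[OF inv] spd_matricesD(1)[OF sq(1)] by (simp add: r_def)
  have rpr: "r ** p ** r = mat 1"
    by (subst sq(2)[symmetric]) (simp add: rr matrix_mul_assoc)
  have "transpose (r ** R ** r) = r ** R ** r"
    by (simp add: matrix_transpose_mul sym R matrix_mul_assoc)
  then obtain U d where U: "orthogonal_matrix U" and d: "transpose U ** (r ** R ** r) ** U = diagm d"
    using spectral_theorem by metis
  have "transpose (r ** U) ** M ** (r ** U) = transpose U ** (r ** M ** r) ** U" for M
    by (simp add: matrix_transpose_mul sym matrix_mul_assoc)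
  then show ?thesis
    using that[of "r ** U" d] U by (simp add: rpr d orthogonal_matrix_def)
qed

text \<open>The first hypothesis says both that \<open>matrix_inv p = S ** transpose S\<close> and
  that \<open>transpose S ** p\<close> inverts \<open>S\<close>. Hence the congruence diagonalizing
  \<open>R\<close> is a similarity diagonalizing \<open>matrix_inv p ** R\<close>.\<close>

lemma eigenvalues_congruence:
  fixes R S :: "real^'n^'n"
  assumes "transpose S ** p ** S = mat 1" "transpose S ** R ** S = diagm d"
  shows "eigenvalues (matrix_inv p ** R) = image_mset d (mset_set UNIV)"
proof -
  have "transpose S ** (p ** S) = mat 1" using assms(1) by (simp add: matrix_mul_assoc)
  then have "p ** S ** transpose S = mat 1" using matrix_left_right_inverse[of "transpose S" "p ** S"] by simp
  then have "matrix_inv p = S ** transpose S"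
    by (intro matrix_inv_eqI) (simp add: matrix_mul_assoc)
  moreover have ST: "S ** (transpose S ** p) = mat 1"
    using assms(1) matrix_left_right_inverse[of "transpose S ** p" S] by simp
  ultimately have "matrix_inv p ** R = S ** (transpose S ** R ** (S ** (transpose S ** p)))"
    by (simp add: matrix_mul_assoc)
  also have "\<dots> = S ** diagm d ** (transpose S ** p)"
    by (simp add: matrix_mul_assoc flip: assms(2))
  finally have "eigenvalues (matrix_inv p ** R) = eigenvalues (diagm d)"
    by (simp add: eigenvalues_def charpoly_similar[OF ST])
  then show ?thesis by (simp add: eigenvalues_diagm)
qed

section \<open>Monotonicity of generalized eigenvalues\<close>

text \<open>If the first count were larger, the span of the eigendirections of \<open>(p, R)\<close> with eigenvalue
  \<open>\<ge> t\<close> would meet that of the eigendirections of \<open>(p', R')\<close> with eigenvalue \<open>< t\<close> in a nonzero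
  vector, for dimension reasons.\<close>

lemma card_eigenvalues_mono:
  fixes S S' :: "real^'n^'n"
  assumes S: "transpose S ** p ** S = mat 1" "transpose S ** R ** S = diagm d"
    and S': "transpose S' ** p' ** S' = mat 1" "transpose S' ** R' ** S' = diagm d'"
    and p: "\<And>v. v \<bullet> (p' *v v) \<le> v \<bullet> (p *v v)"
    and R: "\<And>v. v \<bullet> (R *v v) \<le> v \<bullet> (R' *v v)"
    and t: "0 \<le> t"
  shows "card {i. t \<le> d i} \<le> card {i. t \<le> d' i}"
proof -
  define coord :: "'n set \<Rightarrow> (real^'n) set" where "coord I = {y. \<forall>i. i \<notin> I \<longrightarrow> y $ i = 0}" for I
  have dim_coord: "dim (coord I) = card I" for I
    by (simp only: coord_def dim_substandard_cart flip: dim_vec_eq)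
  have sub_coord: "subspace (coord I)" for I
    by (auto simp: coord_def subspace_def)
  have inj: "inj ((*v) T)" if "transpose T ** q ** T = mat 1" for T q :: "real^'n^'n"
    using that inj_matrix_vector_mult invertible_left_inverse by blast
  define V where "V = (*v) S ` coord {i. t \<le> d i}"
  define W where "W = (*v) S' ` coord {i. d' i < t}"
  have sub: "subspace V" "subspace W"
    unfolding V_def W_def by (auto intro!: linear_subspace_image sub_coord)
  have dimV: "dim V = card {i. t \<le> d i}"
    unfolding V_def by (subst dim_image_eq) (auto intro: inj_on_subset[OF inj[OF S(1)]] simp: dim_coord)
  have dimW: "dim W = card {i. d' i < t}"
    unfolding W_def by (subst dim_image_eq) (auto intro: inj_on_subset[OF inj[OF S'(1)]] simp: dim_coord)
  have "x = 0" if "x \<in> V" "x \<in> W" for x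
  proof (rule ccontr)
    assume "x \<noteq> 0"
    from that obtain y z where y: "x = S *v y" "y \<in> coord {i. t \<le> d i}"
      and z: "x = S' *v z" "z \<in> coord {i. d' i < t}"
      unfolding V_def W_def by blast
    have "z \<noteq> 0" using z \<open>x \<noteq> 0\<close> by auto
    then obtain i where i: "z $ i \<noteq> 0" by (auto simp: vec_eq_iff)
    have norms: "x \<bullet> (p *v x) = (\<Sum>i\<in>UNIV. (y $ i)\<^sup>2)" "x \<bullet> (p' *v x) = (\<Sum>i\<in>UNIV. (z $ i)\<^sup>2)"
    proof -
      show "x \<bullet> (p *v x) = (\<Sum>i\<in>UNIV. (y $ i)\<^sup>2)"
        using inner_diagm[of y "\<lambda>_. 1"] by (simp only: y(1) inner_congruence S(1) diagm_one mult_1)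
      show "x \<bullet> (p' *v x) = (\<Sum>i\<in>UNIV. (z $ i)\<^sup>2)"
        using inner_diagm[of z "\<lambda>_. 1"] by (simp only: z(1) inner_congruence S'(1) diagm_one mult_1)
    qed
    \<comment> \<open>Two readings of the same vector: as an element of \<open>V\<close> its
      quotient of \<open>R\<close> by \<open>p\<close> is at least \<open>t\<close>, as a nonzero
      element of \<open>W\<close> its quotient of \<open>R'\<close> by \<open>p'\<close> is below
      \<open>t\<close>. The assumed inequalities between the forms make these incompatible.\<close>
    have "t * (x \<bullet> (p *v x)) \<le> (\<Sum>i\<in>UNIV. d i * (y $ i)\<^sup>2)"
      unfolding norms sum_distrib_left
    proof (rule sum_mono)
      show "t * (y $ i)\<^sup>2 \<le> d i * (y $ i)\<^sup>2" for i
        using y(2) by (cases "y $ i = 0") (auto simp: coord_def intro!: mult_right_mono)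
    qed
    also have "\<dots> = x \<bullet> (R *v x)"
      by (simp only: y(1) inner_congruence S(2) inner_diagm)
    also have "\<dots> \<le> x \<bullet> (R' *v x)" by (rule R)
    also have "\<dots> = (\<Sum>i\<in>UNIV. d' i * (z $ i)\<^sup>2)"
      by (simp only: z(1) inner_congruence S'(2) inner_diagm)
    also have "\<dots> < (\<Sum>i\<in>UNIV. t * (z $ i)\<^sup>2)"
    proof (rule sum_strict_mono_ex1)
      have "d' j * (z $ j)\<^sup>2 \<le> t * (z $ j)\<^sup>2" for j
        using z(2) by (cases "z $ j = 0") (auto simp: coord_def intro!: mult_right_mono less_imp_le)
      then show "\<forall>j\<in>UNIV. d' j * (z $ j)\<^sup>2 \<le> t * (z $ j)\<^sup>2" by blast
      have "d' i < t" using i z(2) by (auto simp: coord_def)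
      then show "\<exists>j\<in>UNIV. d' j * (z $ j)\<^sup>2 < t * (z $ j)\<^sup>2"
        using i by (intro bexI[of _ i]) auto
    qed simp
    also have "\<dots> = t * (x \<bullet> (p' *v x))" by (simp add: norms sum_distrib_left)
    also have "\<dots> \<le> t * (x \<bullet> (p *v x))" using p t by (rule mult_left_mono)
    finally show False by simp
  qed
  then have "V \<inter> W = {0}"
    using sub by (auto simp: subspace_0)
  \<comment> \<open>Trivial intersection bounds the sum of the dimensions by \<open>n\<close>; as
    \<open>dim W\<close> is \<open>n\<close> minus the second count, this is the claim.\<close>
  then have "dim V + dim W \<le> CARD('n)"
    using dim_sums_Int[OF sub] dim_subset_UNIV[of "{x + y |x y. x \<in> V \<and> y \<in> W}"] by simp
  moreover have "card {i. d' i < t} = CARD('n) - card {i. t \<le> d' i}"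
    by (subst card_Diff_subset[symmetric]) (auto intro: arg_cong[of _ _ card])
  moreover have "card {i. t \<le> d' i} \<le> CARD('n)" by (simp add: card_mono)
  ultimately show ?thesis using dimV dimW by linarith
qed

text \<open>Turns counting into ordering. At the threshold \<open>xs ! i\<close>, the first
  \<open>i + 1\<close> entries of \<open>xs\<close> count; were \<open>ys ! i\<close> smaller, at
  most the first \<open>i\<close> entries of \<open>ys\<close> could.\<close>

lemma nth_mono_of_card_ge:
  fixes xs ys :: "real list"
  assumes "sorted (rev xs)" "sorted (rev ys)" "length xs = length ys" "i < length xs"
    and "size (filter_mset (\<lambda>x. xs ! i \<le> x) (mset xs)) \<le> size (filter_mset (\<lambda>x. xs ! i \<le> x) (mset ys))"
  shows "xs ! i \<le> ys ! i"
proof (rule ccontr)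
  assume less: "\<not> xs ! i \<le> ys ! i"
  have size: "size (filter_mset P (mset zs)) = card {j. j < length zs \<and> P (zs ! j)}" for P and zs :: "real list"
    by (metis length_filter_conv_card mset_filter size_mset)
  have "{..i} \<subseteq> {j. j < length xs \<and> xs ! i \<le> xs ! j}"
    using assms(1,4) by (auto intro: sorted_rev_nth_mono)
  then have "Suc i \<le> card {j. j < length xs \<and> xs ! i \<le> xs ! j}"
    by (subst card_atMost[symmetric], intro card_mono) auto
  moreover have "{j. j < length ys \<and> xs ! i \<le> ys ! j} \<subseteq> {..<i}"
  proof safe
    fix j assume j: "j < length ys" "xs ! i \<le> ys ! j"
    show "j < i"
    proof (rule ccontr)
      assume "\<not> j < i"
      then have "ys ! j \<le> ys ! i" using j assms(2) by (intro sorted_rev_nth_mono) auto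
      with j less show False by linarith
    qed
  qed
  then have "card {j. j < length ys \<and> xs ! i \<le> ys ! j} \<le> i"
    by (subst card_lessThan[symmetric], intro card_mono) auto
  ultimately show False using assms(5) by (simp add: size)
qed

section \<open>Ordered eigenvalues of a pair of positive definite matrices\<close>

definition pencil_eigenvalues :: "real^'n^'n \<Rightarrow> real^'n^'n \<Rightarrow> real list" where
  "pencil_eigenvalues p R = rev (sorted_list_of_multiset (eigenvalues (matrix_inv p ** R)))"

lemma sorted_pencil_eigenvalues: "sorted (rev (pencil_eigenvalues p R))"
  by (simp add: pencil_eigenvalues_def)

lemma mset_pencil_eigenvalues: "mset (pencil_eigenvalues p R) = eigenvalues (matrix_inv p ** R)"
  by (simp add: pencil_eigenvalues_def)

lemma spd_diagonalization:
  fixes R :: "real^'n^'n"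
  assumes "p \<in> spd_matrices" "R \<in> spd_matrices"
  obtains S :: "real^'n^'n" and d where "transpose S ** p ** S = mat 1" "transpose S ** R ** S = diagm d"
    "\<And>i. 0 < d i" "invertible S" "mset (pencil_eigenvalues p R) = image_mset d (mset_set UNIV)"
proof -
  obtain S :: "real^'n^'n" and d where S: "transpose S ** p ** S = mat 1" "transpose S ** R ** S = diagm d"
    using simultaneous_diagonalization[OF assms(1) spd_matricesD(1)[OF assms(2)]] by blast
  moreover have "invertible S" using S(1) invertible_left_inverse by blast
  moreover have "0 < d i" for i
    using spd_congruence[OF assms(2) \<open>invertible S\<close>] by (simp add: S(2) diagm_spd_iff)
  moreover have "mset (pencil_eigenvalues p R) = image_mset d (mset_set UNIV)"
    using eigenvalues_congruence[OF S] by (simp add: mset_pencil_eigenvalues)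
  ultimately show ?thesis using that by blast
qed

lemma length_pencil_eigenvalues:
  fixes p :: "real^'n^'n"
  assumes "p \<in> spd_matrices" "R \<in> spd_matrices"
  shows "length (pencil_eigenvalues p R) = CARD('n)"
proof -
  obtain d where "mset (pencil_eigenvalues p R) = image_mset d (mset_set (UNIV :: 'n set))"
    using spd_diagonalization[OF assms] by blast
  then have "size (mset (pencil_eigenvalues p R)) = size (image_mset d (mset_set (UNIV :: 'n set)))" by simp
  then show ?thesis by simp
qed

lemma pencil_eigenvalues_pos:
  fixes p :: "real^'n^'n"
  assumes "p \<in> spd_matrices" "R \<in> spd_matrices" "l \<in> set (pencil_eigenvalues p R)"
  shows "0 < l"
proof -
  obtain d where d: "mset (pencil_eigenvalues p R) = image_mset d (mset_set (UNIV :: 'n set))" "\<And>i. 0 < d i"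
    using spd_diagonalization[OF assms(1,2)] by blast
  have "set (pencil_eigenvalues p R) = range d"
    using arg_cong[OF d(1), of set_mset] by simp
  then show ?thesis using assms(3) d(2) by auto
qed

lemma det_spd_pos:
  fixes p :: "real^'n^'n"
  assumes "p \<in> spd_matrices"
  shows "0 < det p"
proof -
  obtain S :: "real^'n^'n" where S: "transpose S ** p ** S = mat 1"
    using simultaneous_diagonalization[OF assms spd_matricesD(1)[OF assms]] by metis
  from arg_cong[OF this, of det] have "(det S)\<^sup>2 * det p = 1"
    by (simp add: det_mul power2_eq_square mult_ac)
  then show ?thesis by (smt (verit) zero_le_power2 zero_less_mult_iff)
qed

text \<open>Taking determinants in both congruences, the factor \<open>(det S)\<^sup>2\<close>
  cancels, and the product of the eigenvalues is \<open>det R / det p\<close>.\<close>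

lemma sum_mset_ln_pencil_eigenvalues:
  fixes p :: "real^'n^'n"
  assumes "p \<in> spd_matrices" "R \<in> spd_matrices"
  shows "(\<Sum>l\<in>#mset (pencil_eigenvalues p R). ln l) = ln (det R) - ln (det p)"
proof -
  obtain S :: "real^'n^'n" and d where S: "transpose S ** p ** S = mat 1" "transpose S ** R ** S = diagm d"
    and pos: "\<And>i. 0 < d i" and m: "mset (pencil_eigenvalues p R) = image_mset d (mset_set UNIV)"
    using spd_diagonalization[OF assms] by blast
  have p: "(det S)\<^sup>2 * det p = 1"
    using arg_cong[OF S(1), of det] by (simp add: det_mul power2_eq_square mult_ac)
  have R: "(det S)\<^sup>2 * det R = prod d UNIV"
    using arg_cong[OF S(2), of det] by (simp add: det_mul det_diagm power2_eq_square mult_ac)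
  have "(\<Sum>l\<in>#mset (pencil_eigenvalues p R). ln l) = (\<Sum>i\<in>UNIV. ln (d i))"
    by (simp add: m image_mset.compositionality o_def sum_unfold_sum_mset)
  also have "\<dots> = ln (prod d UNIV)"
    using pos by (subst ln_prod) (auto simp: less_imp_neq[THEN not_sym])
  also have "prod d UNIV = det R / det p"
  proof -
    have "prod d UNIV * det p = det R" using p R by algebra
    then show ?thesis using det_spd_pos[OF assms(1)] by (simp add: field_simps)
  qed
  finally show ?thesis
    using det_spd_pos[OF assms(1)] det_spd_pos[OF assms(2)] by (simp add: ln_div)
qed

lemma pencil_eigenvalues_mono:
  fixes p :: "real^'n^'n"
  assumes spd: "p \<in> spd_matrices" "p' \<in> spd_matrices" "R \<in> spd_matrices" "R' \<in> spd_matrices"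
    and p: "\<And>v. v \<bullet> (p' *v v) \<le> v \<bullet> (p *v v)"
    and R: "\<And>v. v \<bullet> (R *v v) \<le> v \<bullet> (R' *v v)"
    and i: "i < CARD('n)"
  shows "0 < pencil_eigenvalues p R ! i" "pencil_eigenvalues p R ! i \<le> pencil_eigenvalues p' R' ! i"
proof -
  note len = length_pencil_eigenvalues[OF spd(1,3)] length_pencil_eigenvalues[OF spd(2,4)]
  show pos: "0 < pencil_eigenvalues p R ! i"
    using i len by (intro pencil_eigenvalues_pos[OF spd(1,3)]) auto
  obtain S :: "real^'n^'n" and d where S: "transpose S ** p ** S = mat 1" "transpose S ** R ** S = diagm d"
    and d: "mset (pencil_eigenvalues p R) = image_mset d (mset_set UNIV)"
    using spd_diagonalization[OF spd(1,3)] by blast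
  obtain S' :: "real^'n^'n" and d' where S': "transpose S' ** p' ** S' = mat 1" "transpose S' ** R' ** S' = diagm d'"
    and d': "mset (pencil_eigenvalues p' R') = image_mset d' (mset_set UNIV)"
    using spd_diagonalization[OF spd(2,4)] by blast
  show "pencil_eigenvalues p R ! i \<le> pencil_eigenvalues p' R' ! i"
    \<comment> \<open>The counts are compared at the \<open>i\<close>-th eigenvalue itself, whose
      positivity supplies the nonnegative threshold.\<close>
    using i len card_eigenvalues_mono[OF S S' p R, of "pencil_eigenvalues p R ! i"] pos
    by (intro nth_mono_of_card_ge sorted_pencil_eigenvalues) (simp_all add: d d' filter_mset_image_mset filter_mset_mset_set less_imp_le)
qed

section \<open>Weighted sums of logarithms under changes of the two forms\<close>

definition weighted_log_sum :: "(nat \<Rightarrow> real) \<Rightarrow> real^'n^'n \<Rightarrow> real^'n^'n \<Rightarrow> real" where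
  "weighted_log_sum w p R = (\<Sum>i<CARD('n). w i * ln (pencil_eigenvalues p R ! i))"

lemma weighted_log_sum_mono:
  fixes p :: "real^'n^'n"
  assumes spd: "p \<in> spd_matrices" "p' \<in> spd_matrices" "R \<in> spd_matrices" "R' \<in> spd_matrices"
    and p: "\<And>v. v \<bullet> (p' *v v) \<le> v \<bullet> (p *v v)"
    and R: "\<And>v. v \<bullet> (R *v v) \<le> v \<bullet> (R' *v v)"
    and w: "\<And>i. 0 \<le> w i" "\<And>i. w i \<le> 1"
  shows "weighted_log_sum w p R \<le> weighted_log_sum w p' R'"
    and "weighted_log_sum w p' R' \<le> weighted_log_sum w p R + (ln (det R') - ln (det R)) + (ln (det p) - ln (det p'))"
proof -
  have le: "ln (pencil_eigenvalues p R ! i) \<le> ln (pencil_eigenvalues p' R' ! i)" if "i < CARD('n)" for i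
    using pencil_eigenvalues_mono[OF spd p R that] by simp
  show "weighted_log_sum w p R \<le> weighted_log_sum w p' R'"
    unfolding weighted_log_sum_def by (intro sum_mono mult_left_mono le w) auto
  have sum_ln: "(\<Sum>i<CARD('n). ln (pencil_eigenvalues q Q ! i)) = ln (det Q) - ln (det q)"
    if "q \<in> spd_matrices" "Q \<in> spd_matrices" for q Q :: "real^'n^'n"
  proof -
    have "(\<Sum>l\<in>#mset (pencil_eigenvalues q Q). ln l) = sum_list (map ln (pencil_eigenvalues q Q))"
      by (metis mset_map sum_mset_sum_list)
    also have "\<dots> = (\<Sum>i<CARD('n). ln (pencil_eigenvalues q Q ! i))"
      by (simp add: sum_list_sum_nth length_pencil_eigenvalues[OF that] atLeast0LessThan)
    finally show ?thesis by (simp add: sum_mset_ln_pencil_eigenvalues[OF that])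
  qed
  have "weighted_log_sum w p' R' - weighted_log_sum w p R = (\<Sum>i<CARD('n). w i * (ln (pencil_eigenvalues p' R' ! i) - ln (pencil_eigenvalues p R ! i)))"
    by (simp add: weighted_log_sum_def sum_subtractf right_diff_distrib)
  \<comment> \<open>Each increment is nonnegative, so replacing its weight by 1 can only enlarge the
    sum, which then telescopes into log-determinants.\<close>
  also have "\<dots> \<le> (\<Sum>i<CARD('n). ln (pencil_eigenvalues p' R' ! i) - ln (pencil_eigenvalues p R ! i))"
    using le w by (intro sum_mono mult_left_le_one_le) auto
  also have "\<dots> = (ln (det R') - ln (det p')) - (ln (det R) - ln (det p))"
    by (simp add: sum_subtractf sum_ln spd)
  finally show "weighted_log_sum w p' R' \<le> weighted_log_sum w p R + (ln (det R') - ln (det R)) + (ln (det p) - ln (det p'))"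
    by simp
qed

text \<open>The bound \<open>m\<close> is the entrywise maximum of \<open>p\<close> and \<open>q\<close> in coordinates that diagonalize both, so that
  the sum of the two log-determinant ratios is the \<open>\<ell>\<^sup>1\<close>-norm of the logarithms of the eigenvalues
  of \<open>p\<^sup>-\<^sup>1 q\<close>.\<close>

lemma spd_upper_bound:
  fixes p :: "real^'n^'n"
  assumes "p \<in> spd_matrices" "q \<in> spd_matrices"
  obtains m where "m \<in> spd_matrices"
    "\<And>v. v \<bullet> (p *v v) \<le> v \<bullet> (m *v v)" "\<And>v. v \<bullet> (q *v v) \<le> v \<bullet> (m *v v)"
    "(ln (det m) - ln (det p)) + (ln (det m) - ln (det q))
      \<le> sqrt (real CARD('n)) * spd_dist p q"
proof -
  obtain S :: "real^'n^'n" and d where S: "transpose S ** p ** S = mat 1" "transpose S ** q ** S = diagm d"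
    and pos: "\<And>i. 0 < d i" and inv: "invertible S"
    and m: "mset (pencil_eigenvalues p q) = image_mset d (mset_set UNIV)"
    using spd_diagonalization[OF assms] by blast
  define T where "T = matrix_inv S"
  note ST = matrix_inv_inverse[OF inv, folded T_def]
  have invT: "invertible T" using ST by (auto simp: invertible_def)
  have tST: "transpose T ** transpose S = mat 1"
    by (metis ST(1) matrix_transpose_mul transpose_mat)
  have conj: "M = transpose T ** (transpose S ** M ** S) ** T" for M
    by (simp add: matrix_mul_assoc tST) (simp add: ST flip: matrix_mul_assoc)
  \<comment> \<open>In the coordinates given by \<open>T\<close>, \<open>p\<close> is the identity
    and \<open>q\<close> is \<open>diagm d\<close>, so their entrywise maximum is
    \<open>e\<close>.\<close>
  have p: "p = transpose T ** diagm (\<lambda>_. 1) ** T" and q: "q = transpose T ** diagm d ** T"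
    using conj[of p] conj[of q] by (simp_all only: S diagm_one)
  define e where "e i = max 1 (d i)" for i
  define M where "M = transpose T ** diagm e ** T"
  have le: "v \<bullet> ((transpose T ** diagm a ** T) *v v) \<le> v \<bullet> (M *v v)" if "\<And>i. a i \<le> e i" for a v
    unfolding M_def using that
    by (auto simp: inner_diagm intro!: sum_mono mult_right_mono simp flip: inner_congruence)
  have spdM: "M \<in> spd_matrices"
    unfolding M_def using invT by (intro spd_congruence) (auto simp: diagm_spd_iff e_def)
  have detT: "det T \<noteq> 0" using ST by (metis det_I det_mul mult_zero_left zero_neq_one)
  have ln_det: "ln (det (transpose T ** diagm a ** T)) = ln ((det T)\<^sup>2) + (\<Sum>i\<in>UNIV. ln (a i))"
    if "\<And>i. 0 < a i" for a
  proof -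
    have "det (transpose T ** diagm a ** T) = (det T)\<^sup>2 * prod a UNIV"
      by (simp add: det_mul det_diagm power2_eq_square mult_ac)
    moreover have "0 < prod a UNIV" using that by (simp add: prod_pos)
    moreover have "ln (prod a UNIV) = (\<Sum>i\<in>UNIV. ln (a i))"
      using that by (intro ln_prod) (auto simp: less_imp_neq[THEN not_sym])
    ultimately show ?thesis using detT that by (simp add: ln_mult less_imp_neq[THEN not_sym])
  qed
  have dist: "spd_dist p q = sqrt (\<Sum>i\<in>UNIV. (ln (d i))\<^sup>2)"
    using m by (simp add: spd_dist_def mset_pencil_eigenvalues image_mset.compositionality o_def sum_unfold_sum_mset)
  have "(ln (det M) - ln (det p)) + (ln (det M) - ln (det q)) = (\<Sum>i\<in>UNIV. 2 * ln (e i) - ln (d i))"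
    unfolding M_def using ln_det[of e] ln_det[of "\<lambda>_. 1"] ln_det[of d] pos
    by (simp add: e_def sum_subtractf sum_distrib_left flip: p q)
  \<comment> \<open>Both signs of \<open>ln (d i)\<close> give
    \<open>2 * ln (max 1 (d i)) - ln (d i) = \<bar>ln (d i)\<bar>\<close>. The factor 1 prepares
    Cauchy--Schwarz against the all-ones vector, the source of the square root of
    \<open>n\<close>.\<close>
  also have "\<dots> = (\<Sum>i\<in>UNIV. 1 * \<bar>ln (d i)\<bar>)"
    using pos by (intro sum.cong) (auto simp: e_def max_def abs_if ln_less_zero_iff)
  also have "\<dots> \<le> L2_set (\<lambda>i. 1) (UNIV :: 'n set) * L2_set (\<lambda>i. \<bar>ln (d i)\<bar>) UNIV"
    using L2_set_mult_ineq[of "\<lambda>i. 1" "\<lambda>i. ln (d i)" "UNIV :: 'n set"] by (simp add: L2_set_def)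
  also have "\<dots> = sqrt (real CARD('n)) * spd_dist p q"
    by (simp add: L2_set_def dist)
  finally show ?thesis
    using le[of "\<lambda>_. 1"] le[of d] spdM that[of M] by (simp add: e_def flip: p q)
qed

text \<open>One half of the Lipschitz bound. The error term is symmetric in \<open>p\<close> and
  \<open>q\<close>, so exchanging them with the same \<open>m\<close> bounds the absolute
  value.\<close>

lemma weighted_log_sum_le_of_upper_bound:
  fixes p A :: "real^'n^'n"
  assumes spd: "p \<in> spd_matrices" "q \<in> spd_matrices" and A: "invertible A"
    and m: "m \<in> spd_matrices"
    and pm: "\<And>v. v \<bullet> (p *v v) \<le> v \<bullet> (m *v v)" and qm: "\<And>v. v \<bullet> (q *v v) \<le> v \<bullet> (m *v v)"
    and w: "\<And>i. 0 \<le> w i" "\<And>i. w i \<le> 1"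
  shows "weighted_log_sum w p (transpose A ** p ** A) \<le> weighted_log_sum w q (transpose A ** q ** A)
    + ((ln (det m) - ln (det p)) + (ln (det m) - ln (det q)))"
proof -
  define R where "R r = transpose A ** r ** A" for r
  have R: "R r \<in> spd_matrices" if "r \<in> spd_matrices" for r
    unfolding R_def using that A by (rule spd_congruence)
  have Rle: "v \<bullet> (R r *v v) \<le> v \<bullet> (R m *v v)" if "\<And>v. v \<bullet> (r *v v) \<le> v \<bullet> (m *v v)" for r v
    unfolding R_def using that by (simp flip: inner_congruence)
  have detA: "det A \<noteq> 0" using A by (simp add: invertible_det_nz)
  have detR: "ln (det (R r)) = ln ((det A)\<^sup>2) + ln (det r)" if "r \<in> spd_matrices" for r
  proof -
    have "det (R r) = (det A)\<^sup>2 * det r" by (simp add: R_def det_mul power2_eq_square mult_ac)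
    then show ?thesis using detA det_spd_pos[OF that] by (simp add: ln_mult)
  qed
  have "weighted_log_sum w p (R p) \<le> weighted_log_sum w p (R m)"
    using spd m pm w by (intro weighted_log_sum_mono(1) R Rle) auto
  also have "\<dots> \<le> weighted_log_sum w m (R m) + (ln (det m) - ln (det p))"
    using weighted_log_sum_mono(2)[OF m spd(1) R[OF m] R[OF m] pm _ w] by simp
  \<comment> \<open>By \<open>detR\<close> the contribution of \<open>A\<close> cancels, so this
    costs only \<open>ln (det m) - ln (det q)\<close>.\<close>
  also have "weighted_log_sum w m (R m) \<le> weighted_log_sum w m (R q) + (ln (det (R m)) - ln (det (R q)))"
    using weighted_log_sum_mono(2)[OF m m R[OF spd(2)] R[OF m] _ Rle[OF qm] w] by simp
  also have "weighted_log_sum w m (R q) \<le> weighted_log_sum w q (R q)"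
    using spd m qm w by (intro weighted_log_sum_mono(1) R) auto
  finally show ?thesis using spd m by (simp add: R_def[symmetric] detR)
qed

section \<open>The Lipschitz estimate\<close>

lemma J2_eq_weighted_log_sum:
  fixes \<phi> :: "real^'n \<Rightarrow> real^'n" and s :: real
  assumes p: "p \<in> spd_matrices" and A: "invertible (jacobian \<phi> (at x))" and k: "k < CARD('n)"
  defines "w \<equiv> \<lambda>i. if i < k then 1 else if i = k then s else 0"
  shows "J2 \<phi> k s x p = weighted_log_sum w p (transpose (jacobian \<phi> (at x)) ** p ** jacobian \<phi> (at x)) / (2 * ln 2)"
proof -
  define A where "A = jacobian \<phi> (at x)"
  define r where "r = spd_sqrt p"
  define R where "R = transpose A ** p ** A"
  note sq = spd_sqrt[OF p, folded r_def]
  have R: "R \<in> spd_matrices" unfolding R_def A_def using p A by (rule spd_congruence)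
  note inv = spd_invertible[OF sq(1)] and rr = matrix_inv_inverse[OF spd_invertible[OF sq(1)]]
  have sym: "transpose r = r" "transpose (matrix_inv r) = matrix_inv r"
    using spd_matricesD(1)[OF sq(1)] transpose_matrix_inv[OF inv] by simp_all
  have pinv: "matrix_inv p = matrix_inv r ** matrix_inv r"
  proof (rule matrix_inv_eqI)
    have "p ** (matrix_inv r ** matrix_inv r) = r ** (r ** matrix_inv r) ** matrix_inv r"
      by (simp add: matrix_mul_assoc sq(2))
    then show "p ** (matrix_inv r ** matrix_inv r) = mat 1" by (simp add: rr)
  qed
  define B where "B = r ** A ** matrix_inv r"
  have "transpose B ** B = matrix_inv r ** transpose A ** (r ** r) ** A ** matrix_inv r"
    by (simp only: B_def matrix_transpose_mul sym matrix_mul_assoc)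
  \<comment> \<open>Inserting \<open>r ** matrix_inv r\<close> on the left exposes
    \<open>matrix_inv p\<close> and displays the product as conjugate by \<open>r\<close> to
    \<open>matrix_inv p ** R\<close>.\<close>
  also have "\<dots> = (r ** matrix_inv r) ** matrix_inv r ** transpose A ** p ** A ** matrix_inv r"
    by (simp add: sq rr)
  also have "\<dots> = r ** (matrix_inv p ** R) ** matrix_inv r"
    by (simp only: pinv R_def matrix_mul_assoc)
  finally have "eigenvalues (transpose B ** B) = eigenvalues (matrix_inv p ** R)"
    by (simp add: eigenvalues_def charpoly_similar rr)
  then have sv: "singular_value i B = sqrt (pencil_eigenvalues p R ! (i - 1))" for i
    by (simp add: singular_value_def pencil_eigenvalues_def)
  have pos: "0 < pencil_eigenvalues p R ! i" if "i < CARD('n)" for i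
    using that length_pencil_eigenvalues[OF p R] by (intro pencil_eigenvalues_pos[OF p R]) auto
  \<comment> \<open>Singular values are numbered from 1, list entries from 0. The square root in the
    singular value accounts for the 2 in the denominator.\<close>
  have log: "log 2 (singular_value (Suc i) B) = ln (pencil_eigenvalues p R ! i) / (2 * ln 2)" if "i < CARD('n)" for i
    using pos[OF that] by (simp add: sv log_def ln_sqrt)
  have "J2 \<phi> k s x p = (\<Sum>i<k. log 2 (singular_value (Suc i) B)) + s * log 2 (singular_value (Suc k) B)"
    by (simp add: J2_def Let_def B_def A_def r_def sum.atLeast1_atMost_eq)
  also have "\<dots> = (\<Sum>i<k. ln (pencil_eigenvalues p R ! i) / (2 * ln 2)) + s * (ln (pencil_eigenvalues p R ! k) / (2 * ln 2))"
    using k by (simp add: log)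
  also have "\<dots> = (\<Sum>i<Suc k. w i * ln (pencil_eigenvalues p R ! i)) / (2 * ln 2)"
    by (simp add: w_def sum_divide_distrib[symmetric] add_divide_distrib)
  also have "(\<Sum>i<Suc k. w i * ln (pencil_eigenvalues p R ! i)) = weighted_log_sum w p R"
    unfolding weighted_log_sum_def using k by (intro sum.mono_neutral_left) (auto simp: w_def)
  finally show ?thesis by (simp add: R_def A_def)
qed

lemma spd_dist_nonneg: "0 \<le> spd_dist p q"
  proof -
  have "0 \<le> (\<Sum>l\<in>#M. (ln l)\<^sup>2)" for M :: "real multiset"
    by (induction M) auto
  then show ?thesis by (simp add: spd_dist_def)
qed

theorem lemma4p4:
  fixes \<phi> :: "real^'n \<Rightarrow> real^'n" and K :: "(real^'n) set"
    and x :: "real^'n" and k :: nat and s :: real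
  assumes "\<phi> differentiable_on UNIV"
    and "continuous_on UNIV (\<lambda>y. jacobian \<phi> (at y))"
    and "compact K"
    and "\<phi> ` K \<subseteq> K"
    and "K = closure (interior K)"
    and "\<forall>y\<in>K. invertible (jacobian \<phi> (at y))"
    and "x \<in> K"
    and "k \<in> {1..CARD('n) - 1}"
    and "0 \<le> s" and "s < 1"
  shows "\<forall>p\<in>spd_matrices. \<forall>q\<in>spd_matrices.
           \<bar>J2 \<phi> k s x p - J2 \<phi> k s x q\<bar> \<le> sqrt (real CARD('n)) / ln 2 * spd_dist p q"
proof -
  have A: "invertible (jacobian \<phi> (at x))" and k: "k < CARD('n)" using assms by auto
  define w where "w i = (if i < k then 1 else if i = k then s else 0)" for i
  have w: "0 \<le> w i" "w i \<le> 1" for i using assms(9,10) by (auto simp: w_def)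
  show ?thesis
  proof (intro ballI)
    fix p q :: "real^'n^'n"
    assume pq: "p \<in> spd_matrices" "q \<in> spd_matrices"
    define f where "f r = weighted_log_sum w r (transpose (jacobian \<phi> (at x)) ** r ** jacobian \<phi> (at x))" for r
    have J2: "J2 \<phi> k s x r = f r / (2 * ln 2)" if "r \<in> spd_matrices" for r
      using J2_eq_weighted_log_sum[OF that A k] by (simp add: f_def w_def[abs_def])
    obtain m where m: "m \<in> spd_matrices"
      and pm: "\<And>v. v \<bullet> (p *v v) \<le> v \<bullet> (m *v v)" and qm: "\<And>v. v \<bullet> (q *v v) \<le> v \<bullet> (m *v v)"
      and bound: "(ln (det m) - ln (det p)) + (ln (det m) - ln (det q)) \<le> sqrt (real CARD('n)) * spd_dist p q"
      using spd_upper_bound[OF pq] by blast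
    have "\<bar>f p - f q\<bar> \<le> sqrt (real CARD('n)) * spd_dist p q"
      using weighted_log_sum_le_of_upper_bound[OF pq A m pm qm, of w] w bound
        weighted_log_sum_le_of_upper_bound[OF pq(2,1) A m qm pm, of w] by (simp add: f_def abs_le_iff)
    then have "\<bar>J2 \<phi> k s x p - J2 \<phi> k s x q\<bar> \<le> (sqrt (real CARD('n)) * spd_dist p q) / (2 * ln 2)"
      by (simp add: J2[OF pq(1)] J2[OF pq(2)] abs_mult divide_right_mono flip: diff_divide_distrib)
    \<comment> \<open>The argument yields half the stated constant; the bound is relaxed
      here.\<close>
    also have "\<dots> \<le> (sqrt (real CARD('n)) * spd_dist p q) / ln 2"
      using spd_dist_nonneg[of p q] by (intro divide_left_mono) auto
    finally show "\<bar>J2 \<phi> k s x p - J2 \<phi> k s x q\<bar> \<le> sqrt (real CARD('n)) / ln 2 * spd_dist p q"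
      by simp
  qed
qed

end
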